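(* Let $K=\mathbb{Q}(\sqrt{D})$ where $D\in\mathbb{Z}_{\ge2}$ is squarefree and $D\neq5$, and let $\alpha=(\lceil2\xi_D\rceil+2)+2\omega_D$. (i) If $\lceil\xi_D\rceil-\xi_D>\frac12$, then $p_K(\alpha)=6$. (ii) If $\lceil\xi_D\rceil-\xi_D<\frac12$, then $p_K(\alpha)=9$.
   Context: Let $\omega_D=\sqrt{D}$ and $\xi_D=\sqrt D$ if $D\equiv2,3\pmod4$, and $\omega_D=\frac{1+\sqrt D}{2}$, $\xi_D=\frac{\sqrt D-1}{2}$ if $D\equiv1\pmod4$. $\mathcal{O}_K$ is the ring of integers of $K$ and $\mathcal{O}_K^+$ the set of totally positive elements of $\mathcal{O}_K$ (those $\gamma$ with $\gamma>0$, $\gamma'>0$, $'$ denoting Galois conjugation). A partition of $\alpha\in\mathcal{O}_K^+$ is an expression $\alpha=\alpha_1+\dots+\alpha_n$ with $n\ge1$ and $\alpha_i\in\mathcal{O}_K^+$, order irrelevant; $p_K(\alpha)$ is the number of partitions of $\alpha$. *)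

theory Defs
  imports
    Complex_Main
    "HOL-Library.Multiset"
    "HOL-Computational_Algebra.Polynomial"
    "HOL-Computational_Algebra.Squarefree"
begin

text \<open>
  The real quadratic field \<open>\<rat>(\<surd>D)\<close> is realised inside the real numbers.  All definitions are
  total in \<open>D\<close>, but are only meaningful when \<open>sqrt D\<close> is irrational.
\<close>

definition quad_field :: "int \<Rightarrow> real set" where
  "quad_field D = {a + b * sqrt (of_int D) | a b. a \<in> \<rat> \<and> b \<in> \<rat>}"

definition quad_conj :: "int \<Rightarrow> real \<Rightarrow> real" where
  "quad_conj D x =
     (THE y. \<exists>a\<in>\<rat>. \<exists>b\<in>\<rat>. x = a + b * sqrt (of_int D) \<and> y = a - b * sqrt (of_int D))"

definition ring_of_integers :: "int \<Rightarrow> real set" where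
  "ring_of_integers D = {x \<in> quad_field D. algebraic_int x}"

definition totally_positive :: "int \<Rightarrow> real set" where
  "totally_positive D = {x \<in> ring_of_integers D. x > 0 \<and> quad_conj D x > 0}"

definition omega :: "int \<Rightarrow> real" where
  "omega D = (if D mod 4 = 1 then (1 + sqrt (of_int D)) / 2 else sqrt (of_int D))"

definition xi :: "int \<Rightarrow> real" where
  "xi D = (if D mod 4 = 1 then (sqrt (of_int D) - 1) / 2 else sqrt (of_int D))"

text \<open>
  Partitions are unordered with repetition, hence multisets.  The set of partitions of a totally
  positive integer is finite, so \<^term>\<open>card\<close> is its true cardinality there.
\<close>

definition partitions :: "int \<Rightarrow> real \<Rightarrow> real multiset set" where
  "partitions D \<alpha> = {M. M \<noteq> {#} \<and> set_mset M \<subseteq> totally_positive D \<and> sum_mset M = \<alpha>}"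

definition num_partitions :: "int \<Rightarrow> real \<Rightarrow> nat" where
  "num_partitions D \<alpha> = card (partitions D \<alpha>)"

lemma quad_conj_eq:
  assumes "sqrt (of_int D) \<notin> \<rat>" "a \<in> \<rat>" "b \<in> \<rat>"
  shows "quad_conj D (a + b * sqrt (of_int D)) = a - b * sqrt (of_int D)"
  unfolding quad_conj_def
proof (rule the_equality)
  show "\<exists>a'\<in>\<rat>. \<exists>b'\<in>\<rat>. a + b * sqrt (of_int D) = a' + b' * sqrt (of_int D) \<and>
          a - b * sqrt (of_int D) = a' - b' * sqrt (of_int D)"
    using assms by blast
next
  fix y
  assume "\<exists>a'\<in>\<rat>. \<exists>b'\<in>\<rat>. a + b * sqrt (of_int D) = a' + b' * sqrt (of_int D) \<and>
            y = a' - b' * sqrt (of_int D)"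
  then obtain a' b' where *: "a' \<in> \<rat>" "b' \<in> \<rat>"
    "a + b * sqrt (of_int D) = a' + b' * sqrt (of_int D)" "y = a' - b' * sqrt (of_int D)"
    by blast
  have "b = b'"
  proof (rule ccontr)
    assume "b \<noteq> b'"
    with *(3) have "sqrt (of_int D) = (a' - a) / (b - b')"
      by (simp add: field_simps)
    with assms *(1,2) show False
      by (metis Rats_diff Rats_divide)
  qed
  with * show "y = a - b * sqrt (of_int D)" by simp
qed

end

theory Submission
  imports Defs
begin

text \<open>
  Write integers as \<open>x + y \<omega>\<close>. The conjugate of \<open>\<omega>\<close> is \<open>-\<xi>\<close>, so total positivity means
  \<open>x + y \<omega> > 0\<close> and \<open>x - y \<xi> > 0\<close>. The slack \<open>x - y \<xi>\<close> is additive and less than 3 at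
  \<open>\<alpha>\<close>, whereas it is at least 3 at every totally positive integer with \<open>y < 0\<close> (this is where
  \<open>D \<noteq> 5\<close> enters). Hence all parts have \<open>y \<ge> 0\<close>, and the heights \<open>y\<close> add up to 2. With
  \<open>m = \<lceil>\<xi>\<rceil>\<close> and \<open>C = \<lceil>2 \<xi>\<rceil>\<close>, a part of height 0, 1 or 2 is one with \<open>x \<ge> 1\<close>,
  \<open>x \<ge> m\<close> or \<open>x \<ge> C\<close>, respectively. There are 4 partitions with a part of height 2, and 2 or 5
  with two parts of height 1, according as \<open>C = 2 m - 1\<close> or \<open>C = 2 m\<close>.
\<close>

section \<open>Irrationality of \<open>sqrt D\<close> and monic equations for quadratic
  irrationals\<close>

text \<open>A square root of an integer is an algebraic integer, so if rational it is an integer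
  \<open>k\<close>. Then \<open>D = k\<^sup>2\<close> is squarefree only if \<open>k\<close> is a
  unit, that is, if \<open>D = 1\<close>.\<close>

lemma sqrt_squarefree_irrational:
  fixes D :: int
  assumes "D \<ge> 2" "squarefree D"
  shows "sqrt (of_int D) \<notin> \<rat>"
proof
  assume "sqrt (of_int D) \<in> \<rat>"
  moreover have "algebraic_int (sqrt (of_int D))" by auto
  ultimately have "sqrt (of_int D) \<in> \<int>"
    using rational_algebraic_int_is_int by blast
  then obtain k where k: "sqrt (of_int D) = of_int k" by (auto elim: Ints_cases)
  have "of_int D = (sqrt (of_int D))\<^sup>2" using assms by simp
  then have "(of_int D :: real) = of_int (k\<^sup>2)" unfolding k by simp
  then have D: "D = k\<^sup>2" by linarith
  then have "k dvd 1" using assms(2) squarefreeD[of D k] by simp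
  then have "k\<^sup>2 = 1" by (metis power2_abs power_one zdvd1_eq)
  with D assms(1) show False by simp
qed

abbreviation of_int_poly :: "int poly \<Rightarrow> 'a :: comm_ring_1 poly" where
  "of_int_poly \<equiv> map_poly of_int"

lemma of_int_poly_add: "of_int_poly (p + q) = of_int_poly p + of_int_poly q"
  by (intro poly_eqI) (simp add: coeff_map_poly)

lemma of_int_poly_mult: "of_int_poly (p * q) = of_int_poly p * of_int_poly q"
  by (intro poly_eqI) (simp add: coeff_map_poly coeff_mult)

lemma of_int_poly_smult: "of_int_poly (smult c p) = smult (of_int c) (of_int_poly p)"
  by (intro poly_eqI) (simp add: coeff_map_poly)

text \<open>By Gauss's lemma the primitive part of \<open>f\<close> divides every monic integral polynomial
  vanishing at \<open>x\<close>, hence is itself monic up to sign.\<close>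

lemma algebraic_int_quadratic:
  fixes x :: real and f :: "int poly"
  assumes f: "degree f = 2" "poly (of_int_poly f) x = 0"
    and x: "algebraic_int x" "x \<notin> \<rat>"
  obtains b c :: int where "x\<^sup>2 + of_int b * x + of_int c = 0"
proof -
  define g where "g = primitive_part f"
  have f0: "f \<noteq> 0" using f(1) by auto
  then have g0: "g \<noteq> 0" and dg: "degree g = 2" and cg: "content g = 1"
    by (auto simp: g_def f(1))
  have fg: "f = smult (content f) g" by (simp add: g_def)
  have "of_int_poly f = smult (of_int (content f)) (of_int_poly g :: real poly)"
    by (subst fg) (simp add: of_int_poly_add of_int_poly_mult of_int_poly_smult)
  then have gx: "poly (of_int_poly g) x = 0" using f(2) f0 by simp
  obtain p :: "int poly" where p: "poly (of_int_poly p) x = 0" "lead_coeff p = 1"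
    using x(1) by (auto simp: algebraic_int_altdef_ipoly)
  \<comment> \<open>Over the integers, division by \<open>g\<close> with remainder first needs
    \<open>p\<close> multiplied by the power \<open>e\<close> of the leading coefficient of
    \<open>g\<close>. The remainder has degree below 2 and vanishes at the irrational
    \<open>x\<close>, so it is zero.\<close>
  obtain q r where qr: "pseudo_divmod p g = (q, r)" by fastforce
  define e where "e = lead_coeff g ^ (Suc (degree p) - degree g)"
  have e0: "e \<noteq> 0" using g0 by (simp add: e_def)
  have eq: "smult e p = g * q + r" and dr: "r = 0 \<or> degree r < 2"
    using pseudo_divmod[OF g0 qr] dg by (auto simp: e_def)
  have "poly (of_int_poly (smult e p)) x = poly (of_int_poly (g * q + r)) x"
    by (simp only: eq)
  then have rx: "poly (of_int_poly r) x = 0" 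
    using gx p(1) by (simp add: of_int_poly_add of_int_poly_mult of_int_poly_smult)
  have "degree r < 2" using dr by auto
  then have r: "r = [:coeff r 0, coeff r 1:]"
    by (intro poly_eqI) (auto simp: coeff_pCons coeff_eq_0 split: nat.splits)
  have rx': "of_int (coeff r 0) + x * of_int (coeff r 1) = (0::real)"
    using rx by (subst (asm) r) (simp add: map_poly_pCons)
  have "coeff r 1 = 0"
  proof (rule ccontr)
    assume "coeff r 1 \<noteq> 0"
    then have "x = - of_int (coeff r 0) / of_int (coeff r 1)"
      using rx' by (simp add: field_simps)
    then show False using x(2) by (metis Rats_divide Rats_minus_iff Rats_of_int)
  qed
  moreover from this rx' have "coeff r 0 = 0" by simp
  ultimately have "r = 0" using r by simp
  then have eq: "smult e p = g * q" using eq by simp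
  have "content p dvd lead_coeff p" by (rule content_dvd_coeff)
  then have cp: "content p = 1" using p(2) by (metis is_unit_content_iff)
  \<comment> \<open>Contents are multiplicative and \<open>p\<close>, \<open>g\<close> are
    primitive, so the auxiliary factor \<open>e\<close> sits entirely in \<open>q\<close> and can be
    cancelled.\<close>
  have "normalize e = content q"
    using arg_cong[OF eq, of content] by (simp add: content_mult cp cg)
  then have "e dvd content q" by (metis dvd_refl normalize_dvd_iff)
  then obtain q' where q': "q = smult e q'"
    by (auto simp flip: const_poly_dvd_iff_dvd_content elim!: dvdE)
  have "smult e p = smult e (g * q')" using eq q' by simp
  then have "smult e (p - g * q') = 0" by (simp add: smult_diff_right)
  then have "p = g * q'" using e0 by simp
  then have "lead_coeff g * lead_coeff q' = 1" using p(2) by (metis lead_coeff_mult)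
  then have lg: "lead_coeff g * lead_coeff g = 1"
    by (auto simp: zmult_eq_1_iff)
  have "degree (of_int_poly g :: real poly) = 2"
    using dg by (simp add: degree_map_poly)
  then have "poly (of_int_poly g) x = of_int (coeff g 0) + of_int (coeff g 1) * x + of_int (coeff g 2) * x\<^sup>2"
    by (simp add: poly_altdef coeff_map_poly numeral_2_eq_2)
  \<comment> \<open>The leading coefficient of \<open>g\<close> is 1 or -1, hence its own inverse;
    multiplying by it makes the equation monic.\<close>
  then have "of_int (coeff g 2) * (of_int (coeff g 0) + of_int (coeff g 1) * x + of_int (coeff g 2) * x\<^sup>2) = 0"
    using gx by simp
  moreover have "of_int (coeff g 2) * of_int (coeff g 2) = (1::real)"
    using lg dg by (metis of_int_1 of_int_mult)
  moreover have "of_int (coeff g 2) * (of_int (coeff g 0) + of_int (coeff g 1) * x + of_int (coeff g 2) * x\<^sup>2)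
      = of_int (coeff g 2) * of_int (coeff g 2) * x\<^sup>2
        + of_int (coeff g 2 * coeff g 1) * x + of_int (coeff g 2 * coeff g 0)"
    by (simp add: algebra_simps)
  ultimately have "x\<^sup>2 + of_int (coeff g 2 * coeff g 1) * x + of_int (coeff g 2 * coeff g 0) = 0"
    by (metis mult_1)
  then show ?thesis using that by blast
qed

section \<open>Multisets of positive integers with sum at most 2\<close>

lemma pos_int_mset_sum_le_2:
  fixes T :: "int multiset"
  assumes "\<forall>t\<in>#T. t \<ge> 1"
  shows "sum_mset T \<ge> 0"
    and "sum_mset T = 0 \<Longrightarrow> T = {#}"
    and "sum_mset T = 1 \<Longrightarrow> T = {#1#}"
    and "sum_mset T = 2 \<Longrightarrow> T = {#2#} \<or> T = {#1, 1#}"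
proof -
  have nonneg: "sum_mset S \<ge> 0" if "\<forall>t\<in>#S. t \<ge> 1" for S :: "int multiset"
    using that by (induction S) auto
  have zero: "S = {#}" if "\<forall>t\<in>#S. t \<ge> 1" "sum_mset S = 0" for S :: "int multiset"
    using that nonneg by (cases S) fastforce+
  have one: "S = {#1#}" if "\<forall>t\<in>#S. t \<ge> 1" "sum_mset S = 1" for S :: "int multiset"
  proof (cases S)
    case (add t R)
    then have "t \<ge> 1" "\<forall>t\<in>#R. t \<ge> 1" "t + sum_mset R = 1" using that by auto
    then show ?thesis using nonneg[of R] zero[of R] add by auto
  qed (use that in simp)
  show "sum_mset T \<ge> 0" "sum_mset T = 0 \<Longrightarrow> T = {#}" "sum_mset T = 1 \<Longrightarrow> T = {#1#}"
    using assms nonneg zero one by blast+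
  show "T = {#2#} \<or> T = {#1, 1#}" if "sum_mset T = 2"
  proof (cases T)
    case (add t R)
    then have *: "t \<ge> 1" "\<forall>t\<in>#R. t \<ge> 1" "t + sum_mset R = 2" using that assms by auto
    then have "t = 1 \<or> t = 2" using nonneg[of R] by linarith
    then show ?thesis using * zero[of R] one[of R] add by auto
  qed (use that in simp)
qed

section \<open>The ring of integers as the integer span of 1 and \<open>omega D\<close>\<close>

text \<open>For \<open>s = u / v\<close> in lowest terms, \<open>v\<^sup>2\<close> divides
  \<open>D * u\<^sup>2\<close>, hence divides the squarefree \<open>D\<close>.\<close>

lemma int_square_mult_squarefree:
  fixes D :: int and s :: real
  assumes D: "squarefree D" and s: "s \<in> \<rat>" and Ds: "of_int D * s\<^sup>2 \<in> \<int>"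
  shows "s \<in> \<int>"
proof -
  from s obtain u v :: int where uv: "v > 0" "coprime u v" "s = of_int u / of_int v"
    by (rule Rats_cases')
  from Ds obtain n where n: "of_int D * s\<^sup>2 = of_int n" by (auto elim: Ints_cases)
  then have "of_int (D * u\<^sup>2) = (of_int (n * v\<^sup>2) :: real)"
    using uv by (simp add: field_simps)
  then have "D * u\<^sup>2 = n * v\<^sup>2" by linarith
  then have "v\<^sup>2 dvd D * u\<^sup>2" by simp
  moreover have "coprime (v\<^sup>2) (u\<^sup>2)" using uv(2) by (simp add: coprime_commute)
  ultimately have "v\<^sup>2 dvd D" by (simp add: coprime_dvd_mult_left_iff)
  then have "v dvd 1" using D squarefreeD by blast
  then have "v = 1" using uv(1) by simp
  then show ?thesis using uv(3) by simp
qed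

lemma omega_conv_half:
  "D mod 4 = 1 \<Longrightarrow> of_int x + of_int y * omega D
      = (of_int x + of_int y / 2) + (of_int y / 2) * sqrt (of_int D)"
  "D mod 4 \<noteq> 1 \<Longrightarrow> of_int x + of_int y * omega D = of_int x + of_int y * sqrt (of_int D)"
  by (simp_all add: omega_def field_simps)

lemma algebraic_int_omega_span:
  assumes "D \<ge> 0"
  shows "algebraic_int (of_int x + of_int y * omega D)" (is "algebraic_int ?z")
proof (cases "D mod 4 = 1")
  case True
  define k where "k = D div 4"
  have D: "of_int D = 4 * of_int k + (1::real)"
    using True mult_div_mod_eq[of 4 D] unfolding k_def by linarith
  have w: "(omega D)\<^sup>2 = omega D + of_int k"
  proof -
    have "(sqrt (of_int D))\<^sup>2 = of_int D" using assms by simp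
    moreover have "sqrt (of_int D) = 2 * omega D - 1" using True by (simp add: omega_def field_simps)
    ultimately have "(2 * omega D - 1)\<^sup>2 = 4 * of_int k + 1" by (simp only: D)
    then show ?thesis by (simp add: power2_eq_square algebra_simps)
  qed
  have wy: "(omega D)\<^sup>2 * (of_int y)\<^sup>2 = (omega D + of_int k) * (of_int y)\<^sup>2"
    by (simp only: w)
  show ?thesis
  proof
    \<comment> \<open>The coefficients are the norm and the negated trace of
      \<open>x + y * omega D\<close>; here \<open>omega D\<close> has trace 1 and norm
      \<open>- k\<close>.\<close>
    show "poly [:of_int (x\<^sup>2 + x * y - k * y\<^sup>2), of_int (- 2 * x - y), 1:] ?z = 0"
      using wy by (simp add: power2_eq_square algebra_simps)
  qed (auto simp: coeff_pCons split: nat.splits)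
next
  case False
  have w: "(omega D)\<^sup>2 = of_int D"
    using assms False by (simp add: omega_def)
  show ?thesis
  proof
    show "poly [:of_int (x\<^sup>2 - D * y\<^sup>2), of_int (- 2 * x), 1:] ?z = 0"
      using w by (simp add: power2_eq_square algebra_simps)
  qed (auto simp: coeff_pCons split: nat.splits)
qed

lemma quad_irrational:
  assumes "sqrt (of_int D) \<notin> \<rat>" "a \<in> \<rat>" "b \<in> \<rat>" "a + b * sqrt (of_int D) \<in> \<rat>"
  shows "b = 0"
proof (rule ccontr)
  assume "b \<noteq> 0"
  then have "sqrt (of_int D) = ((a + b * sqrt (of_int D)) - a) / b" by simp
  then show False using assms by (metis Rats_diff Rats_divide)
qed

text \<open>For \<open>b \<noteq> 0\<close> the element is irrational and satisfies a monic integral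
  quadratic equation. That equation must be the minimal one, whose coefficients are the negated
  trace \<open>- 2 * a\<close> and the norm.\<close>

lemma quad_integer_trace_norm:
  assumes D: "D \<ge> 2" "squarefree D" and ab: "a \<in> \<rat>" "b \<in> \<rat>"
    and alg: "algebraic_int (a + b * sqrt (of_int D))" (is "algebraic_int ?x")
  shows "2 * a \<in> \<int>" and "a\<^sup>2 - of_int D * b\<^sup>2 \<in> \<int>"
proof -
  have irr: "sqrt (of_int D) \<notin> \<rat>" using sqrt_squarefree_irrational D by blast
  have sq: "(sqrt (of_int D))\<^sup>2 = of_int D" using D by simp
  have "2 * a \<in> \<int> \<and> a\<^sup>2 - of_int D * b\<^sup>2 \<in> \<int>"
  proof (cases "b = 0")
    case True
    then have "a \<in> \<int>" using alg ab rational_algebraic_int_is_int by auto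
    then show ?thesis using True by simp
  next
    case False
    then have x: "?x \<notin> \<rat>" using quad_irrational irr ab by blast
    obtain p q :: int where p: "q \<noteq> 0" "a = of_int p / of_int q"
      using ab(1) by (metis Rats_cases' less_irrefl)
    obtain r s :: int where r: "s \<noteq> 0" "b = of_int r / of_int s"
      using ab(2) by (metis Rats_cases' less_irrefl)
    \<comment> \<open>The minimal polynomial with its denominators cleared by
      \<open>q\<^sup>2 * s\<^sup>2\<close>.\<close>
    let ?f = "[:p\<^sup>2 * s\<^sup>2 - D * r\<^sup>2 * q\<^sup>2, - 2 * p * q * s\<^sup>2, q\<^sup>2 * s\<^sup>2:]"
    have "poly (of_int_poly ?f) ?x = of_int (q\<^sup>2 * s\<^sup>2) * (?x\<^sup>2 - 2 * a * ?x + (a\<^sup>2 - of_int D * b\<^sup>2))"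
      using p(1) r(1) unfolding p(2) r(2)
      by (simp add: map_poly_pCons field_simps power2_eq_square)
    also have "?x\<^sup>2 - 2 * a * ?x + (a\<^sup>2 - of_int D * b\<^sup>2) = 0"
      using sq by (simp add: power2_eq_square algebra_simps)
    finally obtain B C :: int where BC: "?x\<^sup>2 + of_int B * ?x + of_int C = 0"
      using algebraic_int_quadratic[of ?f ?x] p(1) r(1) alg x by auto
    \<comment> \<open>Splitting the equation into its rational part and the coefficient of
      \<open>sqrt D\<close> forces both to vanish.\<close>
    have *: "(a\<^sup>2 + of_int D * b\<^sup>2 + of_int B * a + of_int C)
             + (b * (2 * a + of_int B)) * sqrt (of_int D) = 0"
      using BC sq by (simp add: power2_eq_square algebra_simps)
    have "b * (2 * a + of_int B) = 0"
      using quad_irrational[OF irr] * ab by (metis (no_types) Rats_0 Rats_add Rats_mult Rats_of_int Rats_power Rats_number_of)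
    then have B: "2 * a = - of_int B" using False by simp
    have "a\<^sup>2 + of_int D * b\<^sup>2 + of_int B * a + of_int C = 0"
      using * \<open>b * (2 * a + of_int B) = 0\<close> by simp
    moreover have "of_int B * a = - 2 * a\<^sup>2" using arg_cong[OF B, of "\<lambda>u. u * a"] by (simp add: power2_eq_square)
    ultimately have "a\<^sup>2 - of_int D * b\<^sup>2 = of_int C" by simp
    with B show ?thesis by simp
  qed
  then show "2 * a \<in> \<int>" "a\<^sup>2 - of_int D * b\<^sup>2 \<in> \<int>" by auto
qed

text \<open>To be applied with \<open>t = 2 * a\<close> and \<open>s = 2 * b\<close>, where
  divisibility by 4 expresses integrality of the norm. Squares are 0 or 1 modulo 4, so genuine
  half-integers survive only for \<open>D mod 4 = 1\<close>.\<close>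

lemma four_dvd_square_diff:
  fixes D s t :: int
  assumes "4 dvd t\<^sup>2 - D * s\<^sup>2" "D mod 4 \<noteq> 0"
  shows "if D mod 4 = 1 then even (t - s) else even t \<and> even s"
proof -
  have sq: "n\<^sup>2 mod 4 = (if even n then 0 else 1)" for n :: int
  proof (cases "even n")
    case False
    then obtain k where "n = 2 * k + 1" by (auto elim: oddE)
    then have "n\<^sup>2 = 1 + 4 * (k\<^sup>2 + k)" by (simp add: power2_eq_square algebra_simps)
    then have "n\<^sup>2 mod 4 = 1" by presburger
    then show ?thesis using False by simp
  qed auto
  have "t\<^sup>2 mod 4 = D * s\<^sup>2 mod 4" using assms(1) by (simp add: mod_eq_dvd_iff)
  also have "\<dots> = (D mod 4) * (s\<^sup>2 mod 4) mod 4" by (simp add: mod_mult_eq)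
  finally have *: "t\<^sup>2 mod 4 = (D mod 4) * (s\<^sup>2 mod 4) mod 4" .
  have "D mod 4 \<in> {1, 2, 3}" using assms(2) by auto
  then show ?thesis using * unfolding sq by (auto split: if_splits)
qed

lemma squarefree_mod_4: "squarefree D \<Longrightarrow> D mod 4 \<noteq> (0 :: int)"
  using squarefreeD[of D 2] by auto

lemma ring_of_integers_eq:
  assumes D: "D \<ge> 2" "squarefree D"
  shows "ring_of_integers D = (\<lambda>(x, y). of_int x + of_int y * omega D) ` UNIV"
proof (intro equalityI subsetI)
  fix z assume "z \<in> ring_of_integers D"
  then obtain a b where ab: "a \<in> \<rat>" "b \<in> \<rat>" "z = a + b * sqrt (of_int D)"
    and alg: "algebraic_int (a + b * sqrt (of_int D))"
    by (auto simp: ring_of_integers_def quad_field_def)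
  obtain t where t: "2 * a = of_int t"
    using quad_integer_trace_norm(1)[OF D ab(1,2) alg] by (auto elim: Ints_cases)
  obtain n where n: "a\<^sup>2 - of_int D * b\<^sup>2 = of_int n"
    using quad_integer_trace_norm(2)[OF D ab(1,2) alg] by (auto elim: Ints_cases)
  \<comment> \<open>Four times the norm relation has only integers besides
    \<open>D * (2 * b)\<^sup>2\<close>, which puts \<open>2 * b\<close> in reach of
    \<open>int_square_mult_squarefree\<close>.\<close>
  have "of_int D * (2 * b)\<^sup>2 = (2 * a)\<^sup>2 - 4 * of_int n"
    using n by (simp add: power2_eq_square)
  also have "\<dots> = of_int (t\<^sup>2 - 4 * n)" using t by simp
  finally have N: "of_int D * (2 * b)\<^sup>2 = of_int (t\<^sup>2 - 4 * n)" .
  then have "2 * b \<in> \<int>" using int_square_mult_squarefree[OF D(2), of "2 * b"] ab(2) by simp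
  then obtain s where s: "2 * b = of_int s" by (auto elim: Ints_cases)
  have "of_int (D * s\<^sup>2) = (of_int (t\<^sup>2 - 4 * n) :: real)" using N s by simp
  then have "D * s\<^sup>2 = t\<^sup>2 - 4 * n" by linarith
  then have "4 dvd t\<^sup>2 - D * s\<^sup>2" by simp
  then have par: "if D mod 4 = 1 then even (t - s) else even t \<and> even s"
    using four_dvd_square_diff squarefree_mod_4 D(2) by blast
  show "z \<in> (\<lambda>(x, y). of_int x + of_int y * omega D) ` UNIV"
  proof (cases "D mod 4 = 1")
    case True
    then have "even (t - s)" using par by simp
    then obtain k where "t - s = 2 * k" by (rule evenE)
    then have "t = s + 2 * k" by simp
    then have "a = of_int k + of_int s / 2" "b = of_int s / 2" using t s by auto
    then have "z = of_int k + of_int s * omega D"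
      using omega_conv_half(1)[OF True] ab(3) by simp
    then show ?thesis by (intro image_eqI[of _ _ "(k, s)"]) auto
  next
    case False
    then obtain k l where "t = 2 * k" "s = 2 * l" using par by (auto elim!: evenE)
    then have "a = of_int k" "b = of_int l" using t s by auto
    then have "z = of_int k + of_int l * omega D"
      unfolding omega_conv_half(2)[OF False] ab(3) by simp
    then show ?thesis by (intro image_eqI[of _ _ "(k, l)"]) auto
  qed
next
  fix z assume "z \<in> (\<lambda>(x, y). of_int x + of_int y * omega D) ` UNIV"
  then obtain x y :: int where z: "z = of_int x + of_int y * omega D" by auto
  have "z \<in> quad_field D"
  proof (cases "D mod 4 = 1")
    case True
    have "of_int x + of_int y / 2 \<in> (\<rat> :: real set)" "of_int y / 2 \<in> (\<rat> :: real set)" by auto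
    then show ?thesis unfolding z omega_conv_half(1)[OF True] quad_field_def by blast
  next
    case False
    have "of_int x \<in> (\<rat> :: real set)" "of_int y \<in> (\<rat> :: real set)" by auto
    then show ?thesis unfolding z omega_conv_half(2)[OF False] quad_field_def by blast
  qed
  then show "z \<in> ring_of_integers D"
    using algebraic_int_omega_span D unfolding z ring_of_integers_def by simp
qed

section \<open>Conjugation, total positivity and partitions in integer coordinates\<close>

lemma quad_conj_omega:
  assumes "D \<ge> 2" "squarefree D"
  shows "quad_conj D (of_int x + of_int y * omega D) = of_int x - of_int y * xi D"
proof (cases "D mod 4 = 1")
  case True
  then show ?thesis
    unfolding omega_conv_half(1)[OF True]
    by (subst quad_conj_eq) 
      (use sqrt_squarefree_irrational[OF assms] in \<open>auto simp: xi_def field_simps\<close>)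
next
  case False
  then show ?thesis
    unfolding omega_conv_half(2)[OF False]
    by (subst quad_conj_eq) 
      (use sqrt_squarefree_irrational[OF assms] in \<open>auto simp: xi_def field_simps\<close>)
qed

lemma omega_irrational:
  assumes "D \<ge> 2" "squarefree D"
  shows "omega D \<notin> \<rat>"
proof
  assume r: "omega D \<in> \<rat>"
  have "sqrt (of_int D) = (if D mod 4 = 1 then 2 * omega D - 1 else omega D)"
    by (simp add: omega_def field_simps)
  also have "\<dots> \<in> \<rat>" using r by auto
  finally show False using sqrt_squarefree_irrational[OF assms] by simp
qed

lemma inj_omega_span:
  assumes "D \<ge> 2" "squarefree D"
  shows "inj (\<lambda>(x, y). of_int x + of_int y * omega D)"
proof (rule injI, clarify)
  fix x y x' y' :: int
  assume *: "of_int x + of_int y * omega D = of_int x' + of_int y' * omega D"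
  have "y = y'"
  proof (rule ccontr)
    assume "y \<noteq> y'"
    then have "omega D = of_int (x' - x) / of_int (y - y')"
      using * by (simp add: field_simps)
    then show False using omega_irrational[OF assms] by (metis Rats_divide Rats_of_int)
  qed
  with * show "x = x' \<and> y = y'" by simp
qed

definition positive_coords :: "int \<Rightarrow> (int \<times> int) set" where
  "positive_coords D = {(x, y). of_int x + of_int y * omega D > 0 \<and> of_int x - of_int y * xi D > 0}"

lemma totally_positive_eq:
  assumes "D \<ge> 2" "squarefree D"
  shows "totally_positive D = (\<lambda>(x, y). of_int x + of_int y * omega D) ` positive_coords D"
  unfolding totally_positive_def ring_of_integers_eq[OF assms] positive_coords_def
  by (auto simp: quad_conj_omega[OF assms])

text \<open>Coordinates are unique, so multisets of totally positive integers correspond to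
  multisets of pairs, and one equation between reals splits into two between integers. Nonemptiness
  is encoded in \<open>d \<noteq> 0\<close>.\<close>

lemma num_partitions_eq:
  assumes D: "D \<ge> 2" "squarefree D" and "d \<noteq> 0"
  shows "num_partitions D (of_int c + of_int d * omega D) =
    card {N. set_mset N \<subseteq> positive_coords D \<and>
             (\<Sum>p\<in>#N. fst p) = c \<and> (\<Sum>p\<in>#N. snd p) = d}" (is "_ = card ?S")
proof -
  let ?g = "\<lambda>(x, y). of_int x + of_int y * omega D"
  have inj: "inj ?g" by (rule inj_omega_span[OF D])
  have sum: "sum_mset (image_mset ?g N) = ?g (\<Sum>p\<in>#N. fst p, \<Sum>p\<in>#N. snd p)" for N
    by (induction N) (auto simp: algebra_simps)
  have "partitions D (of_int c + of_int d * omega D) = image_mset ?g ` ?S"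
  proof (intro equalityI subsetI)
    fix M assume "M \<in> partitions D (of_int c + of_int d * omega D)"
    then have M: "set_mset M \<subseteq> ?g ` positive_coords D" "sum_mset M = ?g (c, d)"
      unfolding partitions_def totally_positive_eq[OF D] by auto
    \<comment> \<open>Replaces every part by its coordinate pair.\<close>
    define N where "N = image_mset (inv_into (positive_coords D) ?g) M"
    have "image_mset ?g N = image_mset id M"
      unfolding N_def multiset.map_comp
      by (rule image_mset_cong) (use M(1) in \<open>auto simp: f_inv_into_f subset_iff simp del: split_paired_All\<close>)
    then have MN: "M = image_mset ?g N" by simp
    have "set_mset N \<subseteq> positive_coords D"
      unfolding N_def using M(1) by (auto simp: inv_into_into subset_iff simp del: split_paired_All)
    moreover have "(\<Sum>p\<in>#N. fst p, \<Sum>p\<in>#N. snd p) = (c, d)"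
      using M(2) inj unfolding MN sum by (rule injD[rotated])
    ultimately show "M \<in> image_mset ?g ` ?S" using MN by auto
  next
    fix M assume "M \<in> image_mset ?g ` ?S"
    then obtain N where N: "N \<in> ?S" "M = image_mset ?g N" by blast
    then have "N \<noteq> {#}" using \<open>d \<noteq> 0\<close> by auto
    then show "M \<in> partitions D (of_int c + of_int d * omega D)"
      using N sum[of N] unfolding partitions_def totally_positive_eq[OF D] by auto
  qed
  moreover have "inj_on (image_mset ?g) ?S" using inj
    by (intro inj_on_inverseI[of _ "image_mset (inv ?g)"]) (simp add: multiset.map_comp)
  ultimately show ?thesis unfolding num_partitions_def by (simp add: card_image)
qed

section \<open>Heights and bounds of totally positive integers\<close>

text \<open>Total positivity is a strict condition; away from the integers, strict bounds can be
  stated through ceilings.\<close>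

lemma ceiling_le_iff_less:
  fixes x :: real
  assumes "x \<notin> \<int>"
  shows "\<lceil>x\<rceil> \<le> n \<longleftrightarrow> x < of_int n"
  using assms by (metis Ints_of_int ceiling_le_iff less_eq_real_def)

lemma xi_pos: "D \<ge> 2 \<Longrightarrow> xi D > 0"
  by (cases "D mod 4 = 1") (simp_all add: xi_def)

lemma omega_pos: "D \<ge> 2 \<Longrightarrow> omega D > 0"
  by (cases "D mod 4 = 1") (simp_all add: omega_def add_pos_nonneg)

lemma omega_plus_xi: "D mod 4 = 1 \<Longrightarrow> omega D + xi D = sqrt (of_int D)"
  by (simp add: omega_def xi_def field_simps)

text \<open>For \<open>y < 0\<close>, positivity of the element itself forces
  \<open>x > omega D\<close>, while the slack is at least \<open>x + xi D\<close>.\<close>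

lemma positive_coords_neg_slack:
  assumes D: "D \<ge> 2" "squarefree D" "D \<noteq> 5" and p: "(x, y) \<in> positive_coords D" "y < 0"
  shows "of_int x - of_int y * xi D \<ge> 3"
proof -
  have y: "of_int y \<le> (-1 :: real)" using p(2) by linarith
  have "omega D \<le> - of_int y * omega D" "xi D \<le> - of_int y * xi D"
    using y xi_pos[OF D(1)] omega_pos[OF D(1)] mult_right_mono[of 1 "- of_int y :: real"] by fastforce+
  then have x: "of_int x > omega D" and *: "of_int x - of_int y * xi D \<ge> of_int x + xi D"
    using p(1) by (auto simp: positive_coords_def)
  show ?thesis
  proof (cases "D mod 4 = 1")
    case True
    moreover have "D \<noteq> 9"
      using D(2) squarefreeD[of "9::int" 3] by auto
    \<comment> \<open>Among the integers from 2 to 8 only 5 is 1 modulo 4, and \<open>sqrt 5\<close>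
      is less than 3.\<close>
    ultimately have "D \<ge> 9" using D by presburger
    then have "sqrt (of_int D) \<ge> 3" by (intro real_le_rsqrt) simp
    then show ?thesis using x * omega_plus_xi[OF True] by linarith
  next
    case False
    have "sqrt (of_int D) > 1" using D(1) by simp
    then have "omega D > 1" "xi D > 1" using False by (auto simp: omega_def xi_def)
    \<comment> \<open>Integrality of \<open>x\<close> matters: for \<open>D = 2\<close> the bound
      \<open>omega D + xi D\<close> is \<open>2 * sqrt 2\<close>, still below 3.\<close>
    then have "x \<ge> 2" using x by linarith
    then have "of_int x \<ge> (2::real)" by simp
    then show ?thesis using * \<open>xi D > 1\<close> by linarith
  qed
qed

lemma sum_mset_nonneg:
  fixes f :: "'a \<Rightarrow> 'b :: ordered_comm_monoid_add"
  shows "(\<And>x. x \<in># M \<Longrightarrow> f x \<ge> 0) \<Longrightarrow> (\<Sum>x\<in>#M. f x) \<ge> 0"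
  by (induction M) auto

text \<open>The other parts have positive slack, so one part of negative height would alone exceed
  the slack available to the whole sum.\<close>

lemma snd_nonneg:
  assumes D: "D \<ge> 2" "squarefree D" "D \<noteq> 5" and N: "set_mset N \<subseteq> positive_coords D"
    and sums: "of_int (\<Sum>p\<in>#N. fst p) - of_int (\<Sum>p\<in>#N. snd p) * xi D < 3"
    and p: "p \<in># N"
  shows "snd p \<ge> 0"
proof (rule ccontr)
  assume neg: "\<not> snd p \<ge> 0"
  let ?s = "\<lambda>p. of_int (fst p) - of_int (snd p) * xi D"
  have sum: "(\<Sum>p\<in>#M. ?s p) = of_int (\<Sum>p\<in>#M. fst p) - of_int (\<Sum>p\<in>#M. snd p) * xi D" for M
    by (induction M) (auto simp: algebra_simps)
  obtain R where R: "N = add_mset p R" using p by (metis mset_add)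
  have "(\<Sum>p\<in>#R. ?s p) \<ge> 0"
    using N unfolding R by (intro sum_mset_nonneg) (fastforce simp: positive_coords_def)
  moreover have "?s p \<ge> 3"
    using positive_coords_neg_slack[OF D, of "fst p" "snd p"] N neg R by auto
  ultimately have "(\<Sum>p\<in>#N. ?s p) \<ge> 3" unfolding R by simp
  then show False using sums unfolding sum by simp
qed

text \<open>For heights 1 and 2 positivity of the conjugate gives \<open>x > 0\<close>, and
  positivity of the element follows since \<open>omega D > 0\<close>. Irrationality of
  \<open>xi D\<close> turns the remaining strict bound into a ceiling.\<close>

lemma positive_coords_small:
  assumes D: "D \<ge> 2" "squarefree D"
  shows "(x, 0) \<in> positive_coords D \<longleftrightarrow> x \<ge> 1"
    and "(x, 1) \<in> positive_coords D \<longleftrightarrow> x \<ge> \<lceil>xi D\<rceil>"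
    and "(x, 2) \<in> positive_coords D \<longleftrightarrow> x \<ge> \<lceil>2 * xi D\<rceil>"
proof -
  have "xi D \<notin> \<rat>" 
  proof
    assume r: "xi D \<in> \<rat>"
    \<comment> \<open>\<open>omega D\<close> and \<open>xi D\<close> differ by an integer, so
      irrationality carries over.\<close>
    have "omega D = (if D mod 4 = 1 then 1 else 0) + xi D"
      by (simp add: omega_def xi_def field_simps)
    also have "\<dots> \<in> \<rat>" using r by auto
    finally show False using omega_irrational[OF D] by simp
  qed
  moreover from this have "2 * xi D \<notin> \<rat>"
    using Rats_divide[of "2 * xi D" 2] by auto
  ultimately have irr: "xi D \<notin> \<int>" "2 * xi D \<notin> \<int>" using Ints_subset_Rats by auto
  note pos = xi_pos[OF D(1)] omega_pos[OF D(1)]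
  show "(x, 0) \<in> positive_coords D \<longleftrightarrow> x \<ge> 1" by (auto simp: positive_coords_def)
  show "(x, 1) \<in> positive_coords D \<longleftrightarrow> x \<ge> \<lceil>xi D\<rceil>"
    using pos unfolding ceiling_le_iff_less[OF irr(1)] by (auto simp: positive_coords_def)
  show "(x, 2) \<in> positive_coords D \<longleftrightarrow> x \<ge> \<lceil>2 * xi D\<rceil>"
    using pos unfolding ceiling_le_iff_less[OF irr(2)] by (auto simp: positive_coords_def)
qed

section \<open>Enumeration of the multisets of coordinates\<close>

text \<open>At height 0 a multiset is determined by its first coordinates, which reduces the claims
  to multisets of positive integers.\<close>

lemma zero_height_multisets:
  fixes R :: "(int \<times> int) multiset"
  assumes R: "\<forall>p\<in>#R. fst p \<ge> 1 \<and> snd p = 0"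
  shows "(\<Sum>p\<in>#R. fst p) \<ge> 0"
    and "(\<Sum>p\<in>#R. fst p) = 0 \<Longrightarrow> R = {#}"
    and "(\<Sum>p\<in>#R. fst p) = 1 \<Longrightarrow> R = {#(1, 0)#}"
    and "(\<Sum>p\<in>#R. fst p) = 2 \<Longrightarrow> R = {#(2, 0)#} \<or> R = {#(1, 0), (1, 0)#}"
proof -
  let ?T = "image_mset fst R"
  have "image_mset (\<lambda>x. (x, 0)) ?T = image_mset id R"
    unfolding multiset.map_comp by (rule image_mset_cong) (use R in \<open>auto simp: prod_eq_iff\<close>)
  then have RT: "R = image_mset (\<lambda>x. (x, 0)) ?T" by simp
  have T: "\<forall>t\<in>#?T. t \<ge> 1" using R by auto
  note * = pos_int_mset_sum_le_2[OF T]
  show "(\<Sum>p\<in>#R. fst p) \<ge> 0" by (rule *)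
  show "R = {#}" if "(\<Sum>p\<in>#R. fst p) = 0" using *(2)[OF that] by simp
  show "R = {#(1, 0)#}" if "(\<Sum>p\<in>#R. fst p) = 1" by (subst RT, subst *(3)[OF that]) simp
  show "R = {#(2, 0)#} \<or> R = {#(1, 0), (1, 0)#}" if "(\<Sum>p\<in>#R. fst p) = 2"
    using *(4)[OF that] RT by (metis image_mset_add_mset image_mset_empty)
qed

text \<open>Either one part \<open>(x, 2)\<close> or two parts \<open>(x, 1)\<close> occur; the remaining parts
  \<open>(x, 0)\<close> have total at most 2.\<close>

lemma height_two_multisets:
  fixes N :: "(int \<times> int) multiset" and m C :: int
  assumes C: "C \<in> {2 * m - 1, 2 * m}"
    and N: "\<And>x y. (x, y) \<in># N \<Longrightarrow>
      y \<ge> 0 \<and> (y = 0 \<longrightarrow> x \<ge> 1) \<and> (y = 1 \<longrightarrow> x \<ge> m) \<and> (y = 2 \<longrightarrow> x \<ge> C)"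
    and sums: "(\<Sum>p\<in>#N. fst p) = C + 2" "(\<Sum>p\<in>#N. snd p) = 2"
  shows "N \<in> {{#(C + 2, 2)#}, {#(C + 1, 2), (1, 0)#}, {#(C, 2), (2, 0)#}, {#(C, 2), (1, 0), (1, 0)#}}
     \<union> (if C = 2 * m - 1 then {{#(m, 1), (m, 1), (1, 0)#}, {#(m, 1), (m + 1, 1)#}}
        else {{#(m, 1), (m, 1), (1, 0), (1, 0)#}, {#(m, 1), (m, 1), (2, 0)#},
              {#(m, 1), (m + 1, 1), (1, 0)#}, {#(m, 1), (m + 2, 1)#}, {#(m + 1, 1), (m + 1, 1)#}})"
    (is "N \<in> ?A \<union> ?B")
proof -
  have nonneg: "(\<Sum>p\<in>#M. snd p) \<ge> 0" if "M \<subseteq># N" for M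
    using N that by (intro sum_mset_nonneg) (auto dest: mset_subset_eqD)
  \<comment> \<open>Heights are nonnegative, so a total height of 0 forces every single height to be
    0.\<close>
  have height0: "\<forall>p\<in>#M. fst p \<ge> 1 \<and> snd p = 0" if M: "M \<subseteq># N" "(\<Sum>p\<in>#M. snd p) = 0" for M
  proof
    fix p assume p: "p \<in># M"
    then obtain L where L: "M = add_mset p L" by (metis mset_add)
    have "L \<subseteq># N" using M(1) unfolding L by (meson mset_subset_eq_insertD subset_mset.less_imp_le)
    moreover have "snd p + (\<Sum>p\<in>#L. snd p) = 0" using M(2) unfolding L by simp
    moreover have "p \<in># N" using p M(1) by (rule mset_subset_eqD[rotated])
    ultimately have "snd p = 0" using nonneg[of L] N[of "fst p" "snd p"] by simp
    then show "fst p \<ge> 1 \<and> snd p = 0" using N[of "fst p" 0] \<open>p \<in># N\<close> by (cases p) simp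
  qed
  \<comment> \<open>Splits off a part of positive height, bounded by the total because the rest has
    nonnegative height. Used once on \<open>N\<close>, and again on the rest if the first part has
    height 1.\<close>
  have pick: "\<exists>x y L. M = add_mset (x, y) L \<and> 1 \<le> y \<and> y \<le> (\<Sum>p\<in>#M. snd p) \<and> L \<subseteq># N \<and> (x, y) \<in># N"
    if M: "M \<subseteq># N" "(\<Sum>p\<in>#M. snd p) > 0" for M
  proof -
    have "\<exists>p\<in>#M. snd p \<noteq> 0" using M(2) by (metis less_irrefl sum_mset.neutral[of "image_mset snd M"] imageE set_image_mset)
    then obtain x y where p: "(x, y) \<in># M" "y \<noteq> 0" by auto
    then obtain L where L: "M = add_mset (x, y) L" by (metis mset_add)
    have LN: "L \<subseteq># N" using M(1) unfolding L by (meson mset_subset_eq_insertD subset_mset.less_imp_le)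
    have pN: "(x, y) \<in># N" using p(1) M(1) by (rule mset_subset_eqD[rotated])
    show ?thesis using L LN pN p(2) N[OF pN] nonneg[OF LN] by (intro exI[of _ x] exI[of _ y] exI[of _ L]) auto
  qed
  obtain x y L where L: "N = add_mset (x, y) L" "1 \<le> y" "y \<le> 2" "L \<subseteq># N" "(x, y) \<in># N"
    using pick[of N] sums(2) by auto
  have sumL: "(\<Sum>p\<in>#L. fst p) = C + 2 - x" "(\<Sum>p\<in>#L. snd p) = 2 - y" 
    using sums unfolding L(1) by auto
  consider "y = 2" | "y = 1" using L by linarith
  then show ?thesis
  proof cases
    assume y: "y = 2"
    note Z = zero_height_multisets[OF height0[OF L(4)]]
    have "x \<ge> C" using N[OF L(5)] y by simp
    moreover have "x \<le> C + 2" using Z(1) sumL y by simp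
    ultimately consider "x = C" | "x = C + 1" | "x = C + 2" by linarith
    then have "N \<in> ?A"
    proof cases
      case 1
      then have "L = {#(2, 0)#} \<or> L = {#(1, 0), (1, 0)#}" using Z(4) sumL y by simp
      then show ?thesis unfolding L(1) y 1 by blast
    next
      case 2
      then have "L = {#(1, 0)#}" using Z(3) sumL y by simp
      then show ?thesis unfolding L(1) y 2 by blast
    next
      case 3
      then have "L = {#}" using Z(2) sumL y by simp
      then show ?thesis unfolding L(1) y 3 by blast
    qed
    then show ?thesis by (rule UnI1)
  next
    assume y: "y = 1"
    obtain x' y' R where R: "L = add_mset (x', y') R" "1 \<le> y'" "y' \<le> 1" "R \<subseteq># N" "(x', y') \<in># N"
      using pick[of L] sumL(2) L(4) y by auto
    have y': "y' = 1" using R by simp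
    have sumR: "(\<Sum>p\<in>#R. fst p) = C + 2 - x - x'" "(\<Sum>p\<in>#R. snd p) = 0" 
      using sumL y y' unfolding R(1) by auto
    note Z = zero_height_multisets[OF height0[OF R(4) sumR(2)]]
    have x: "x \<ge> m" "x' \<ge> m" using N[OF L(5)] N[OF R(5)] y y' by auto
    \<comment> \<open>Thus \<open>x + x'\<close> exceeds \<open>2 * m\<close> by at most
      \<open>C + 2 - 2 * m\<close>, which is 1 or 2; the parts of height 0 in \<open>R\<close> make
      up what is missing to \<open>C + 2\<close>.\<close>
    have le: "x + x' \<le> C + 2" using Z(1) sumR by simp
    have NR: "N = {#(x, 1), (x', 1)#} + R" using L(1) R(1) y y' by simp
    have R0: "R = {#}" if "x + x' = C + 2" using Z(2) sumR that by simp
    have R1: "R = {#(1, 0)#}" if "x + x' = C + 1" using Z(3) sumR that by simp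
    have R2: "R = {#(2, 0)#} \<or> R = {#(1, 0), (1, 0)#}" if "x + x' = C" using Z(4) sumR that by simp
    have "N \<in> ?B"
    proof (cases "C = 2 * m - 1")
      case True
      have B: "?B = {{#(m, 1), (m, 1), (1, 0)#}, {#(m, 1), (m + 1, 1)#}}"
        using True by (rule if_P)
      \<comment> \<open>The cases run over ordered pairs; swapped pairs yield the same
        multiset.\<close>
      consider "x = m" "x' = m" | "x = m + 1" "x' = m" | "x = m" "x' = m + 1"
        using x le True by linarith
      then show ?thesis
      proof cases
        case 1
        then have "R = {#(1, 0)#}" using R1 True by simp
        then have "N = {#(m, 1), (m, 1), (1, 0)#}" using NR 1 by simp
        then show ?thesis unfolding B by blast
      next
        case 2
        then have "R = {#}" using R0 True by simp
        then have "N = {#(m, 1), (m + 1, 1)#}" using NR 2 by (simp add: add_mset_commute)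
        then show ?thesis unfolding B by blast
      next
        case 3
        then have "R = {#}" using R0 True by simp
        then have "N = {#(m, 1), (m + 1, 1)#}" using NR 3 by simp
        then show ?thesis unfolding B by blast
      qed
    next
      case False
      then have C: "C = 2 * m" using C by simp
      have B: "?B = {{#(m, 1), (m, 1), (1, 0), (1, 0)#}, {#(m, 1), (m, 1), (2, 0)#},
          {#(m, 1), (m + 1, 1), (1, 0)#}, {#(m, 1), (m + 2, 1)#}, {#(m + 1, 1), (m + 1, 1)#}}"
        using False by (rule if_not_P)
      consider "x = m" "x' = m" | "x = m + 1" "x' = m" | "x = m" "x' = m + 1"
        | "x = m + 2" "x' = m" | "x = m" "x' = m + 2" | "x = m + 1" "x' = m + 1"
        using x le C by linarith
      then show ?thesis
      proof cases
        case 1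
        then have "R = {#(2, 0)#} \<or> R = {#(1, 0), (1, 0)#}" using R2 C by simp
        then have "N = {#(m, 1), (m, 1), (2, 0)#} \<or> N = {#(m, 1), (m, 1), (1, 0), (1, 0)#}"
          using NR 1 by auto
        then show ?thesis unfolding B by blast
      next
        case 2
        then have "R = {#(1, 0)#}" using R1 C by simp
        then have "N = {#(m, 1), (m + 1, 1), (1, 0)#}" using NR 2 by (simp add: add_mset_commute)
        then show ?thesis unfolding B by blast
      next
        case 3
        then have "R = {#(1, 0)#}" using R1 C by simp
        then have "N = {#(m, 1), (m + 1, 1), (1, 0)#}" using NR 3 by simp
        then show ?thesis unfolding B by blast
      next
        case 4
        then have "R = {#}" using R0 C by simp
        then have "N = {#(m, 1), (m + 2, 1)#}" using NR 4 by (simp add: add_mset_commute)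
        then show ?thesis unfolding B by blast
      next
        case 5
        then have "R = {#}" using R0 C by simp
        then have "N = {#(m, 1), (m + 2, 1)#}" using NR 5 by simp
        then show ?thesis unfolding B by blast
      next
        case 6
        then have "R = {#}" using R0 C by simp
        then have "N = {#(m + 1, 1), (m + 1, 1)#}" using NR 6 by simp
        then show ?thesis unfolding B by blast
      qed
    qed
    then show ?thesis by (rule UnI2)
  qed
qed

text \<open>The weights are chosen so that the total weight tells the listed multisets apart.\<close>

lemma card_height_two_multisets:
  fixes m C :: int
  shows "card {{#(C + 2, 2 :: int)#}, {#(C + 1, 2), (1, 0)#}, {#(C, 2), (2, 0)#}, {#(C, 2), (1, 0), (1, 0)#},
      {#(m, 1), (m, 1), (1, 0)#}, {#(m, 1), (m + 1, 1)#}} = 6" (is ?thesis1)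
    and "card {{#(C + 2, 2 :: int)#}, {#(C + 1, 2), (1, 0)#}, {#(C, 2), (2, 0)#}, {#(C, 2), (1, 0), (1, 0)#},
      {#(m, 1), (m, 1), (1, 0), (1, 0)#}, {#(m, 1), (m, 1), (2, 0)#},
      {#(m, 1), (m + 1, 1), (1, 0)#}, {#(m, 1), (m + 2, 1)#}, {#(m + 1, 1), (m + 1, 1)#}} = 9" (is ?thesis2)
proof -
  \<comment> \<open>The squares separate \<open>(2, 0)\<close> from two copies of
    \<open>(1, 0)\<close> (4 against 2), and \<open>(m, 1), (m + 2, 1)\<close> from two copies of
    \<open>(m + 1, 1)\<close> (40 against 20), where linear weights would agree. The scales 1, 10
    and 100 keep the contributions apart.\<close>
  define w :: "int \<times> int \<Rightarrow> int" where
    "w = (\<lambda>(x, y). if y = 0 then x\<^sup>2 else if y = 1 then 10 * (x - m)\<^sup>2 else 100 + 10 * (x - C))"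
  have card: "card (set Ns) = length Ns"
    if "distinct (map (\<lambda>N. \<Sum>p\<in>#N. w p) Ns)" for Ns :: "(int \<times> int) multiset list"
    using that by (intro distinct_card) (simp add: distinct_map)
  show ?thesis1
    using card[of "[{#(C + 2, 2)#}, {#(C + 1, 2), (1, 0)#}, {#(C, 2), (2, 0)#},
      {#(C, 2), (1, 0), (1, 0)#}, {#(m, 1), (m, 1), (1, 0)#}, {#(m, 1), (m + 1, 1)#}]"]
    unfolding list.set by (simp add: w_def)
  show ?thesis2
    using card[of "[{#(C + 2, 2)#}, {#(C + 1, 2), (1, 0)#}, {#(C, 2), (2, 0)#},
      {#(C, 2), (1, 0), (1, 0)#}, {#(m, 1), (m, 1), (1, 0), (1, 0)#}, {#(m, 1), (m, 1), (2, 0)#},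
      {#(m, 1), (m + 1, 1), (1, 0)#}, {#(m, 1), (m + 2, 1)#}, {#(m + 1, 1), (m + 1, 1)#}]"]
    unfolding list.set by (simp add: w_def)
qed

section \<open>The two counts\<close>

theorem theorem6p2:
  fixes D :: int and \<alpha> :: real
  assumes "D \<ge> 2" and "squarefree D" and "D \<noteq> 5"
    and "\<alpha> = of_int (\<lceil>2 * xi D\<rceil> + 2) + 2 * omega D"
  shows "(of_int \<lceil>xi D\<rceil> - xi D > 1 / 2 \<longrightarrow> num_partitions D \<alpha> = 6) \<and>
         (of_int \<lceil>xi D\<rceil> - xi D < 1 / 2 \<longrightarrow> num_partitions D \<alpha> = 9)"
proof -
  define m where "m = \<lceil>xi D\<rceil>"
  define C where "C = \<lceil>2 * xi D\<rceil>"
  note D = assms(1-3)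
  define S where "S = {N. set_mset N \<subseteq> positive_coords D \<and>
    (\<Sum>p\<in>#N. fst p) = C + 2 \<and> (\<Sum>p\<in>#N. snd p) = 2}"
  have num: "num_partitions D \<alpha> = card S"
    using num_partitions_eq[OF D(1,2), of 2 "C + 2"] assms(4) unfolding S_def C_def by simp
  note small = positive_coords_small[OF D(1,2), folded m_def C_def]
  have m: "of_int m - 1 < xi D" "xi D \<le> of_int m" unfolding m_def by linarith+
  have C_less: "of_int C < 2 * xi D + 1" unfolding C_def by linarith
  have coords: "y \<ge> 0 \<and> (y = 0 \<longrightarrow> x \<ge> 1) \<and> (y = 1 \<longrightarrow> x \<ge> m) \<and> (y = 2 \<longrightarrow> x \<ge> C)"
    if N: "N \<in> S" "(x, y) \<in># N" for N x y
  proof -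
    have "(x, y) \<in> positive_coords D" using N by (auto simp: S_def)
    \<comment> \<open>The total slack is \<open>C + 2 - 2 * xi D\<close>, which is below 3 because
      \<open>C < 2 * xi D + 1\<close>.\<close>
    moreover have "y \<ge> 0"
      using snd_nonneg[OF D, of N "(x, y)"] N C_less by (auto simp: S_def)
    ultimately show ?thesis using small by auto
  qed
  have sub: "S \<subseteq> {{#(C + 2, 2)#}, {#(C + 1, 2), (1, 0)#}, {#(C, 2), (2, 0)#}, {#(C, 2), (1, 0), (1, 0)#}}
     \<union> (if C = 2 * m - 1 then {{#(m, 1), (m, 1), (1, 0)#}, {#(m, 1), (m + 1, 1)#}}
        else {{#(m, 1), (m, 1), (1, 0), (1, 0)#}, {#(m, 1), (m, 1), (2, 0)#},
              {#(m, 1), (m + 1, 1), (1, 0)#}, {#(m, 1), (m + 2, 1)#}, {#(m + 1, 1), (m + 1, 1)#}})"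
    (is "S \<subseteq> ?E") if "C \<in> {2 * m - 1, 2 * m}"
  proof
    fix N assume N: "N \<in> S"
    show "N \<in> ?E"
      using height_two_multisets[OF that coords[OF N]] N unfolding S_def by blast
  qed
  show ?thesis
  proof (intro conjI impI)
    assume "of_int \<lceil>xi D\<rceil> - xi D > 1 / 2"
    \<comment> \<open>Here \<open>2 * xi D\<close> lies strictly between \<open>2 * m - 2\<close>
      and \<open>2 * m - 1\<close>.\<close>
    then have "C = 2 * m - 1"
      using m unfolding C_def m_def[symmetric] by (intro ceiling_unique) auto
    \<comment> \<open>One inclusion is \<open>sub\<close>; for the other, every listed multiset has
      admissible parts and the right sums.\<close>
    then have "S = {{#(C + 2, 2)#}, {#(C + 1, 2), (1, 0)#}, {#(C, 2), (2, 0)#}, {#(C, 2), (1, 0), (1, 0)#},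
        {#(m, 1), (m, 1), (1, 0)#}, {#(m, 1), (m + 1, 1)#}}"
      by (intro equalityI order_trans[OF sub]) (simp_all add: S_def small)
    then show "num_partitions D \<alpha> = 6"
      unfolding num by (simp only: card_height_two_multisets)
  next
    assume "of_int \<lceil>xi D\<rceil> - xi D < 1 / 2"
    \<comment> \<open>Here \<open>2 * xi D\<close> lies above \<open>2 * m - 1\<close> and does not
      exceed \<open>2 * m\<close>.\<close>
    then have "C = 2 * m"
      using m unfolding C_def m_def[symmetric] by (intro ceiling_unique) auto
    then have "S = {{#(C + 2, 2)#}, {#(C + 1, 2), (1, 0)#}, {#(C, 2), (2, 0)#}, {#(C, 2), (1, 0), (1, 0)#},
        {#(m, 1), (m, 1), (1, 0), (1, 0)#}, {#(m, 1), (m, 1), (2, 0)#},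
        {#(m, 1), (m + 1, 1), (1, 0)#}, {#(m, 1), (m + 2, 1)#}, {#(m + 1, 1), (m + 1, 1)#}}"
      by (intro equalityI order_trans[OF sub]) (simp_all add: S_def small)
    then show "num_partitions D \<alpha> = 9"
      unfolding num by (simp only: card_height_two_multisets)
  qed
qed

end
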